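(* Let $M\le K\le N$ be positive integers, let $0<\varepsilon<1$, let $\{\varphi_n\}_{n=1}^N\subseteq\mathbb{R}^M$, and let $\{\psi_p\}_{p=1}^P$ be any $\varepsilon$-net for $\mathbb{S}^{M-1}$. Then the optimal lower and upper NERF bounds $\alpha_K,\beta_K$ of $\{\varphi_n\}_{n=1}^N$ are estimated by the $\varepsilon$-approximate NERF bounds $\alpha_{K,\varepsilon},\beta_{K,\varepsilon}$ (computed from the net $\{\psi_p\}_{p=1}^P$) according to $$\tfrac{1}{1-\varepsilon^2}\Bigl(\alpha_{K,\varepsilon}-\tfrac{\varepsilon^2}{1-\varepsilon^2}\beta_{K,\varepsilon}\Bigr)\le\alpha_K\le\alpha_{K,\varepsilon},\qquad \beta_{K,\varepsilon}\le\beta_K\le\tfrac{1}{1-\varepsilon^2}\beta_{K,\varepsilon}.$$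
   Context: $\mathbb{S}^{M-1}$ is the Euclidean unit sphere in $\mathbb{R}^M$, with standard inner product $\langle\cdot,\cdot\rangle$ and norm $\|\cdot\|$. A finite family $\{\psi_p\}_{p=1}^P\subseteq\mathbb{S}^{M-1}$ is an $\varepsilon$-net for $\mathbb{S}^{M-1}$ if for every $x\in\mathbb{S}^{M-1}$ there exists $p$ such that $|\langle x,\psi_p\rangle|^2\ge 1-\varepsilon^2$. The optimal lower and upper NERF (numerically erasure-robust frame) bounds of $\{\varphi_n\}_{n=1}^N$ are $$\alpha_K:=\min_{|\mathcal{K}|=K}\ \min_{\|x\|=1}\sum_{n\in\mathcal{K}}|\langle x,\varphi_n\rangle|^2,\qquad \beta_K:=\max_{|\mathcal{K}|=K}\ \max_{\|x\|=1}\sum_{n\in\mathcal{K}}|\langle x,\varphi_n\rangle|^2,$$ where $\mathcal{K}$ ranges over all $K$-element subsets of $\{1,\dots,N\}$ and $x$ over $\mathbb{R}^M$. The $\varepsilon$-approximate lower and upper NERF bounds associated with the net are $$\alpha_{K,\varepsilon}:=\min_{p=1,\dots,P}\ \sum_{n=1}^K|\langle\psi_p,\varphi_{\sigma(n)}\rangle|^2,\qquad \beta_{K,\varepsilon}:=\max_{p=1,\dots,P}\ \sum_{n=N-K+1}^N|\langle\psi_p,\varphi_{\sigma(n)}\rangle|^2,$$ where $\sigma$ is a $p$-dependent permutation of $\{1,\dots,N\}$ chosen so that the values $|\langle\psi_p,\varphi_{\sigma(n)}\rangle|^2$, $n=1,\dots,N$, are in nondecreasing order. *)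

theory Defs
  imports "HOL-Analysis.Analysis" "HOL-Combinatorics.Permutations"
begin

definition is_eps_net :: "real \<Rightarrow> nat \<Rightarrow> (nat \<Rightarrow> real ^ 'm) \<Rightarrow> bool" where
  "is_eps_net \<epsilon> P \<psi> \<longleftrightarrow>
     (\<forall>p\<in>{1..P}. \<psi> p \<in> sphere 0 1) \<and>
     (\<forall>x\<in>sphere 0 1. \<exists>p\<in>{1..P}. \<bar>x \<bullet> \<psi> p\<bar>\<^sup>2 \<ge> 1 - \<epsilon>\<^sup>2)"

text \<open>The extrema over the unit sphere are written as an infimum and a supremum because Min
  and Max are meaningful only for finite sets. They are attained, by compactness: see the
  two lemmas below.\<close>

definition nerf_lower :: "nat \<Rightarrow> (nat \<Rightarrow> real ^ 'm) \<Rightarrow> nat \<Rightarrow> real" where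
  "nerf_lower N \<phi> K =
     Min ((\<lambda>\<K>. INF x\<in>sphere 0 1. \<Sum>n\<in>\<K>. \<bar>x \<bullet> \<phi> n\<bar>\<^sup>2) `
            {\<K>. \<K> \<subseteq> {1..N} \<and> card \<K> = K})"

definition nerf_upper :: "nat \<Rightarrow> (nat \<Rightarrow> real ^ 'm) \<Rightarrow> nat \<Rightarrow> real" where
  "nerf_upper N \<phi> K =
     Max ((\<lambda>\<K>. SUP x\<in>sphere 0 1. \<Sum>n\<in>\<K>. \<bar>x \<bullet> \<phi> n\<bar>\<^sup>2) `
            {\<K>. \<K> \<subseteq> {1..N} \<and> card \<K> = K})"

lemma inf_sphere_attained:
  fixes \<phi> :: "nat \<Rightarrow> real ^ 'm"
  shows "\<exists>x\<in>sphere 0 1. (\<Sum>n\<in>\<K>. \<bar>x \<bullet> \<phi> n\<bar>\<^sup>2) = (INF y\<in>sphere 0 1. \<Sum>n\<in>\<K>. \<bar>y \<bullet> \<phi> n\<bar>\<^sup>2)"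
proof -
  let ?f = "\<lambda>x. \<Sum>n\<in>\<K>. \<bar>x \<bullet> \<phi> n\<bar>\<^sup>2"
  have "continuous_on (sphere 0 1) ?f"
    by (intro continuous_intros)
  then obtain x where x: "x \<in> sphere 0 1" "\<And>y. y \<in> sphere 0 1 \<Longrightarrow> ?f x \<le> ?f y"
    using continuous_attains_inf[of "sphere (0 :: real ^ 'm) 1" ?f] by auto
  have "(INF y\<in>sphere 0 1. ?f y) = ?f x"
    by (rule cInf_eq_minimum) (use x in auto)
  then show ?thesis
    using x(1) by metis
qed

lemma sup_sphere_attained:
  fixes \<phi> :: "nat \<Rightarrow> real ^ 'm"
  shows "\<exists>x\<in>sphere 0 1. (\<Sum>n\<in>\<K>. \<bar>x \<bullet> \<phi> n\<bar>\<^sup>2) = (SUP y\<in>sphere 0 1. \<Sum>n\<in>\<K>. \<bar>y \<bullet> \<phi> n\<bar>\<^sup>2)"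
proof -
  let ?f = "\<lambda>x. \<Sum>n\<in>\<K>. \<bar>x \<bullet> \<phi> n\<bar>\<^sup>2"
  have "continuous_on (sphere 0 1) ?f"
    by (intro continuous_intros)
  then obtain x where x: "x \<in> sphere 0 1" "\<And>y. y \<in> sphere 0 1 \<Longrightarrow> ?f y \<le> ?f x"
    using continuous_attains_sup[of "sphere (0 :: real ^ 'm) 1" ?f] by auto
  have "(SUP y\<in>sphere 0 1. ?f y) = ?f x"
    by (rule cSup_eq_maximum) (use x in auto)
  then show ?thesis
    using x(1) by metis
qed

definition sorting_perm :: "nat \<Rightarrow> (nat \<Rightarrow> real ^ 'm) \<Rightarrow> real ^ 'm \<Rightarrow> (nat \<Rightarrow> nat) \<Rightarrow> bool" where
  "sorting_perm N \<phi> v \<sigma> \<longleftrightarrow>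
     \<sigma> permutes {1..N} \<and> mono_on {1..N} (\<lambda>n. \<bar>v \<bullet> \<phi> (\<sigma> n)\<bar>\<^sup>2)"

text \<open>A sorting permutation is not unique when there are ties, so it is an argument of the
  approximate bounds; the p-th permutation is \<open>\<sigma> p\<close>. One always exists.\<close>

lemma sorting_perm_exists:
  fixes \<phi> :: "nat \<Rightarrow> real ^ 'm"
  shows "\<exists>\<sigma>. sorting_perm N \<phi> v \<sigma>"
proof -
  let ?g = "\<lambda>n. \<bar>v \<bullet> \<phi> n\<bar>\<^sup>2"
  define xs where "xs = sort_key ?g [1..<Suc N]"
  define \<sigma> where "\<sigma> n = (if n \<in> {1..N} then xs ! (n - 1) else n)" for n
  have len: "length xs = N" and dist: "distinct xs" and set: "set xs = {1..N}"
    unfolding xs_def by auto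
  have "inj_on \<sigma> {1..N}"
    by (rule inj_onI) (use len dist in \<open>auto simp: \<sigma>_def nth_eq_iff_index_eq\<close>)
  moreover have "\<sigma> ` {1..N} \<subseteq> {1..N}"
    using len set nth_mem[of _ xs] by (force simp: \<sigma>_def)
  ultimately have "bij_betw \<sigma> {1..N} {1..N}"
    by (simp add: bij_betw_def endo_inj_surj)
  then have "\<sigma> permutes {1..N}"
    by (rule bij_imp_permutes) (simp only: \<sigma>_def if_False)
  moreover have "sorted (map ?g xs)"
    unfolding xs_def by simp
  then have "mono_on {1..N} (\<lambda>n. ?g (\<sigma> n))"
    using len by (intro mono_onI) (auto simp: \<sigma>_def sorted_iff_nth_mono)
  ultimately show ?thesis
    unfolding sorting_perm_def by blast
qed

definition approx_nerf_lower ::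
  "(nat \<Rightarrow> real ^ 'm) \<Rightarrow> nat \<Rightarrow> (nat \<Rightarrow> real ^ 'm) \<Rightarrow> (nat \<Rightarrow> nat \<Rightarrow> nat) \<Rightarrow> nat \<Rightarrow> real" where
  "approx_nerf_lower \<phi> P \<psi> \<sigma> K =
     Min ((\<lambda>p. \<Sum>n=1..K. \<bar>\<psi> p \<bullet> \<phi> (\<sigma> p n)\<bar>\<^sup>2) ` {1..P})"

definition approx_nerf_upper ::
  "nat \<Rightarrow> (nat \<Rightarrow> real ^ 'm) \<Rightarrow> nat \<Rightarrow> (nat \<Rightarrow> real ^ 'm) \<Rightarrow> (nat \<Rightarrow> nat \<Rightarrow> nat) \<Rightarrow> nat \<Rightarrow> real" where
  "approx_nerf_upper N \<phi> P \<psi> \<sigma> K =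
     Max ((\<lambda>p. \<Sum>n=N-K+1..N. \<bar>\<psi> p \<bullet> \<phi> (\<sigma> p n)\<bar>\<^sup>2) ` {1..P})"

end

theory Submission
  imports Defs
begin

text \<open>A unit vector \<open>x\<close> at which the quadratic form \<open>q(z) = \<Sum>n\<in>\<K>. \<bar>z \<bullet> \<phi> n\<bar>\<^sup>2\<close> is extremal on the sphere
  is an eigenvector of the frame operator, so for a net vector \<open>v = c x + y\<close> with \<open>y\<close> orthogonal
  to \<open>x\<close> and \<open>c\<^sup>2 \<ge> 1 - \<epsilon>\<^sup>2\<close> there is no cross term: \<open>q(v) = c\<^sup>2 q(x) + q(y)\<close>. At the maximum,
  drop \<open>q(y) \<ge> 0\<close>; at the minimum, bound \<open>q(y) \<le> (1 - c\<^sup>2) \<beta>\<close> and insert the estimate for \<open>\<beta>\<close>.\<close>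

section \<open>The quadratic form of a subfamily and bounds for it off the sphere\<close>

definition frame_form :: "(nat \<Rightarrow> real ^ 'm) \<Rightarrow> nat set \<Rightarrow> real ^ 'm \<Rightarrow> real" where
  "frame_form \<phi> \<K> x = (\<Sum>n\<in>\<K>. \<bar>x \<bullet> \<phi> n\<bar>\<^sup>2)"

lemma frame_form_nonneg: "0 \<le> frame_form \<phi> \<K> x"
  unfolding frame_form_def by (simp add: sum_nonneg)

lemma frame_form_scaleR: "frame_form \<phi> \<K> (c *\<^sub>R x) = c\<^sup>2 * frame_form \<phi> \<K> x"
  unfolding frame_form_def by (simp add: power_mult_distrib sum_distrib_left)

lemma frame_form_add:
  "frame_form \<phi> \<K> (x + y) =
     frame_form \<phi> \<K> x + frame_form \<phi> \<K> y + 2 * (\<Sum>n\<in>\<K>. (x \<bullet> \<phi> n) * (y \<bullet> \<phi> n))"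
  unfolding frame_form_def
  by (simp add: inner_add_left power2_sum sum.distrib sum_distrib_left mult.assoc)

lemma frame_form_eq_norm_sgn: "frame_form \<phi> \<K> x = (norm x)\<^sup>2 * frame_form \<phi> \<K> (sgn x)"
proof -
  have "x = norm x *\<^sub>R sgn x"
    by (cases "x = 0") (auto simp: sgn_div_norm)
  then show ?thesis
    by (metis frame_form_scaleR)
qed

text \<open>By homogeneity of degree two, a bound on the sphere extends to all vectors. The
  homogeneous version is needed because the perturbations \<open>x + t *\<^sub>R y\<close> of an
  extremal vector leave the sphere.\<close>

lemma frame_form_le_norm:
  assumes "\<And>z. z \<in> sphere 0 1 \<Longrightarrow> frame_form \<phi> \<K> z \<le> b"
  shows "frame_form \<phi> \<K> x \<le> b * (norm x)\<^sup>2"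
proof (cases "x = 0")
  case True
  then show ?thesis by (simp add: frame_form_def)
next
  case False
  then have "frame_form \<phi> \<K> (sgn x) \<le> b"
    by (intro assms) (simp add: norm_sgn)
  then show ?thesis
    by (subst frame_form_eq_norm_sgn) (simp add: mult.commute mult_right_mono)
qed

lemma norm_le_frame_form:
  assumes "\<And>z. z \<in> sphere 0 1 \<Longrightarrow> b \<le> frame_form \<phi> \<K> z"
  shows "b * (norm x)\<^sup>2 \<le> frame_form \<phi> \<K> x"
proof (cases "x = 0")
  case True
  then show ?thesis by (simp add: frame_form_def)
next
  case False
  then have "b \<le> frame_form \<phi> \<K> (sgn x)"
    by (intro assms) (simp add: norm_sgn)
  then show ?thesis
    by (subst frame_form_eq_norm_sgn) (simp add: mult.commute mult_right_mono)
qed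

section \<open>Orthogonal splitting of the form at an extremal vector\<close>

text \<open>Dividing by t and letting t tend to 0 from either side gives b \<le> 0 and b \<ge> 0.
  This is the first-order condition at an extremum, in a form free of derivatives.\<close>

lemma linear_le_square_imp_zero:
  fixes b c :: real
  assumes "\<And>t. t * b \<le> t\<^sup>2 * c"
  shows "b = 0"
proof (rule ccontr)
  assume "b \<noteq> 0"
  \<comment> \<open>A single t suffices in place of the limit: at t = b / d one has t b = t^2 d,
    which exceeds t^2 c as soon as d is positive and larger than c.\<close>
  define d where "d = \<bar>c\<bar> + 1"
  have "d > 0" "c < d" by (auto simp: d_def)
  have "b / d * b \<le> (b / d)\<^sup>2 * c" by (rule assms)
  also have "\<dots> < (b / d)\<^sup>2 * d"
    using \<open>b \<noteq> 0\<close> \<open>d > 0\<close> \<open>c < d\<close> by simp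
  also have "\<dots> = b / d * b"
    using \<open>d > 0\<close> by (simp add: power2_eq_square)
  finally show False by simp
qed

text \<open>The sign \<open>s = \<plusminus>1\<close> covers minimisers and maximisers at once.\<close>

lemma frame_form_extremal_add:
  assumes ext: "\<And>z. s * frame_form \<phi> \<K> z \<le> s * (frame_form \<phi> \<K> x * (norm z)\<^sup>2)"
    and s: "s = 1 \<or> s = -1" and x: "norm x = 1" and orth: "x \<bullet> y = 0"
  shows "frame_form \<phi> \<K> (c *\<^sub>R x + y) = c\<^sup>2 * frame_form \<phi> \<K> x + frame_form \<phi> \<K> y"
proof -
  let ?q = "frame_form \<phi> \<K>"
  define B where "B = (\<Sum>n\<in>\<K>. (x \<bullet> \<phi> n) * (y \<bullet> \<phi> n))"
  \<comment> \<open>Insert \<open>x + t *\<^sub>R y\<close> into \<open>ext\<close>. By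
    orthogonality its squared norm has no term linear in t, and the constant terms cancel, so the
    cross term stands alone against a multiple of t^2.\<close>
  have "t * (2 * s * B) \<le> t\<^sup>2 * (s * (?q x * (norm y)\<^sup>2 - ?q y))" for t
  proof -
    have "?q (x + t *\<^sub>R y) = ?q x + t\<^sup>2 * ?q y + 2 * (t * B)"
      by (simp add: frame_form_add frame_form_scaleR B_def sum_distrib_left mult.left_commute)
    moreover have "(norm (x + t *\<^sub>R y))\<^sup>2 = 1 + t\<^sup>2 * (norm y)\<^sup>2"
      using norm_add_Pythagorean[of x "t *\<^sub>R y"] orth x
      by (simp add: orthogonal_def power_mult_distrib)
    ultimately show ?thesis
      using ext[of "x + t *\<^sub>R y"] by (simp add: algebra_simps)
  qed
  then have "2 * s * B = 0"
    by (rule linear_le_square_imp_zero)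
  then have "B = 0" using s by auto
  moreover have "(\<Sum>n\<in>\<K>. (c *\<^sub>R x \<bullet> \<phi> n) * (y \<bullet> \<phi> n)) = c * B"
    by (simp add: B_def sum_distrib_left mult.assoc)
  ultimately show ?thesis
    by (simp add: frame_form_add frame_form_scaleR)
qed

lemma unit_vector_decomposition:
  fixes x v :: "real ^ 'm"
  assumes "norm x = 1" and "norm v = 1"
  obtains y where "v = (x \<bullet> v) *\<^sub>R x + y" and "x \<bullet> y = 0" and "(norm y)\<^sup>2 = 1 - (x \<bullet> v)\<^sup>2"
proof
  have 1: "x \<bullet> x = 1" "v \<bullet> v = 1"
    using assms by (auto simp: dot_square_norm)
  show "v = (x \<bullet> v) *\<^sub>R x + (v - (x \<bullet> v) *\<^sub>R x)" by simp
  show "x \<bullet> (v - (x \<bullet> v) *\<^sub>R x) = 0"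
    by (simp add: inner_diff_right 1)
  show "(norm (v - (x \<bullet> v) *\<^sub>R x))\<^sup>2 = 1 - (x \<bullet> v)\<^sup>2"
    unfolding power2_norm_eq_inner
    by (simp add: inner_diff_right inner_diff_left 1 inner_commute[of v x] power2_eq_square)
qed

lemma frame_form_near_maximiser:
  assumes "\<And>z. z \<in> sphere 0 1 \<Longrightarrow> frame_form \<phi> \<K> z \<le> frame_form \<phi> \<K> x"
    and x: "x \<in> sphere 0 1" and v: "v \<in> sphere 0 1"
  shows "(x \<bullet> v)\<^sup>2 * frame_form \<phi> \<K> x \<le> frame_form \<phi> \<K> v"
proof -
  obtain y where y: "v = (x \<bullet> v) *\<^sub>R x + y" "x \<bullet> y = 0"
    using unit_vector_decomposition[of x v] x v by auto
  have "frame_form \<phi> \<K> ((x \<bullet> v) *\<^sub>R x + y) = (x \<bullet> v)\<^sup>2 * frame_form \<phi> \<K> x + frame_form \<phi> \<K> y"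
    by (rule frame_form_extremal_add[where s = 1])
      (use frame_form_le_norm[OF assms(1)] x y in auto)
  then show ?thesis
    using y(1) frame_form_nonneg[of \<phi> \<K> y] by simp
qed

text \<open>The part of \<open>v\<close> orthogonal to \<open>x\<close> has squared norm
  \<open>1 - (x \<bullet> v)\<^sup>2\<close>, and \<open>b\<close> controls the form there. Any
  upper bound on the sphere will do for \<open>b\<close>; the upper NERF bound is inserted
  later.\<close>

lemma frame_form_near_minimiser:
  assumes "\<And>z. z \<in> sphere 0 1 \<Longrightarrow> frame_form \<phi> \<K> x \<le> frame_form \<phi> \<K> z"
    and b: "\<And>z. z \<in> sphere 0 1 \<Longrightarrow> frame_form \<phi> \<K> z \<le> b"
    and x: "x \<in> sphere 0 1" and v: "v \<in> sphere 0 1"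
  shows "frame_form \<phi> \<K> v \<le> (x \<bullet> v)\<^sup>2 * frame_form \<phi> \<K> x + (1 - (x \<bullet> v)\<^sup>2) * b"
proof -
  obtain y where y: "v = (x \<bullet> v) *\<^sub>R x + y" "x \<bullet> y = 0" "(norm y)\<^sup>2 = 1 - (x \<bullet> v)\<^sup>2"
    using unit_vector_decomposition[of x v] x v by auto
  have "frame_form \<phi> \<K> ((x \<bullet> v) *\<^sub>R x + y) = (x \<bullet> v)\<^sup>2 * frame_form \<phi> \<K> x + frame_form \<phi> \<K> y"
    by (rule frame_form_extremal_add[where s = "-1"])
      (use norm_le_frame_form[OF assms(1)] x y in auto)
  moreover have "frame_form \<phi> \<K> y \<le> (1 - (x \<bullet> v)\<^sup>2) * b"
    using frame_form_le_norm[OF b, of y] y(3) by (simp add: mult.commute)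
  ultimately show ?thesis
    using y(1) by simp
qed

section \<open>Extremal K-element sums of sorted values\<close>

text \<open>The common part of \<open>A\<close> and \<open>B\<close> cancels; the two differences
  have equal size, so any bijection between them compares the remaining terms one by one.\<close>

lemma sum_le_sum_exchange:
  fixes f :: "'a \<Rightarrow> real"
  assumes fin: "finite A" "finite B" and card: "card A = card B"
    and le: "\<And>a b. a \<in> A - B \<Longrightarrow> b \<in> B - A \<Longrightarrow> f a \<le> f b"
  shows "sum f A \<le> sum f B"
proof -
  have "card (A - B) = card (B - A)"
    using fin card by (simp add: card_Diff_subset_Int Int_commute)
  then obtain h where h: "bij_betw h (A - B) (B - A)"
    using fin finite_same_card_bij[of "A - B" "B - A"] by auto
  have "sum f (A - B) \<le> (\<Sum>a\<in>A - B. f (h a))"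
    using h by (intro sum_mono le) (auto simp: bij_betw_def)
  also have "\<dots> = sum f (B - A)"
    by (rule sum.reindex_bij_betw[OF h])
  finally show ?thesis
    using sum.Int_Diff[OF fin(1), of f B] sum.Int_Diff[OF fin(2), of f A]
    by (simp add: Int_commute)
qed

lemma sorting_perm_sum_image:
  assumes "sorting_perm N \<phi> v \<sigma>"
  shows "(\<Sum>n\<in>A. \<bar>v \<bullet> \<phi> (\<sigma> n)\<bar>\<^sup>2) = frame_form \<phi> (\<sigma> ` A) v"
  using assms unfolding sorting_perm_def frame_form_def
  by (subst sum.reindex) (auto dest: permutes_inj intro: inj_on_subset)

lemma sorting_perm_image:
  assumes "sorting_perm N \<phi> v \<sigma>" and "A \<subseteq> {1..N}"
  shows "\<sigma> ` A \<subseteq> {1..N}" and "card (\<sigma> ` A) = card A"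
proof -
  have "\<sigma> permutes {1..N}" using assms by (simp add: sorting_perm_def)
  then show "\<sigma> ` A \<subseteq> {1..N}" "card (\<sigma> ` A) = card A"
    using assms(2) permutes_image[of \<sigma> "{1..N}"]
    by (auto intro!: card_image dest: permutes_inj intro: inj_on_subset)
qed

lemma sorting_perm_sum_le:
  assumes \<sigma>: "sorting_perm N \<phi> v \<sigma>"
    and AB: "A \<subseteq> {1..N}" "B \<subseteq> {1..N}" "card A = card B"
    and le: "\<And>a b. a \<in> A - B \<Longrightarrow> b \<in> B - A \<Longrightarrow> a \<le> b"
  shows "frame_form \<phi> (\<sigma> ` A) v \<le> frame_form \<phi> (\<sigma> ` B) v"
proof -
  have mono: "mono_on {1..N} (\<lambda>n. \<bar>v \<bullet> \<phi> (\<sigma> n)\<bar>\<^sup>2)"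
    using \<sigma> by (simp add: sorting_perm_def)
  have "(\<Sum>n\<in>A. \<bar>v \<bullet> \<phi> (\<sigma> n)\<bar>\<^sup>2) \<le> (\<Sum>n\<in>B. \<bar>v \<bullet> \<phi> (\<sigma> n)\<bar>\<^sup>2)"
  proof (rule sum_le_sum_exchange)
    fix a b
    assume "a \<in> A - B" "b \<in> B - A"
    then show "\<bar>v \<bullet> \<phi> (\<sigma> a)\<bar>\<^sup>2 \<le> \<bar>v \<bullet> \<phi> (\<sigma> b)\<bar>\<^sup>2"
      using AB le by (intro mono_onD[OF mono]) auto
  qed (use AB finite_subset in auto)
  then show ?thesis
    by (simp only: sorting_perm_sum_image[OF \<sigma>])
qed

text \<open>Describes a subset by its positions in the sorted order, where comparing values reduces
  to comparing indices.\<close>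

lemma sorting_perm_preimage:
  assumes \<sigma>: "sorting_perm N \<phi> v \<sigma>" and \<K>: "\<K> \<subseteq> {1..N}"
  obtains A where "A \<subseteq> {1..N}" and "\<K> = \<sigma> ` A" and "card A = card \<K>"
proof -
  have "\<sigma> ` {1..N} = {1..N}"
    using \<sigma> by (simp add: sorting_perm_def permutes_image)
  then obtain A where "A \<subseteq> {1..N}" "\<K> = \<sigma> ` A"
    using \<K> by (metis subset_image_iff)
  then show ?thesis
    using that sorting_perm_image(2)[OF \<sigma>] by metis
qed

lemma sorting_perm_first_le:
  assumes \<sigma>: "sorting_perm N \<phi> v \<sigma>" and \<K>: "\<K> \<subseteq> {1..N}" "card \<K> = K" and "K \<le> N"
  shows "frame_form \<phi> (\<sigma> ` {1..K}) v \<le> frame_form \<phi> \<K> v"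
proof -
  obtain A where A: "A \<subseteq> {1..N}" "\<K> = \<sigma> ` A" "card A = card \<K>"
    using sorting_perm_preimage[OF \<sigma> \<K>(1)] .
  \<comment> \<open>A position in \<open>{1..K}\<close> but not in \<open>A\<close> is at most K,
    while one in \<open>A\<close> but not in \<open>{1..K}\<close> exceeds K.\<close>
  show ?thesis
    unfolding A(2) by (rule sorting_perm_sum_le[OF \<sigma>]) (use A \<K> \<open>K \<le> N\<close> in auto)
qed

lemma sorting_perm_le_last:
  assumes \<sigma>: "sorting_perm N \<phi> v \<sigma>" and \<K>: "\<K> \<subseteq> {1..N}" "card \<K> = K" and "K \<le> N"
  shows "frame_form \<phi> \<K> v \<le> frame_form \<phi> (\<sigma> ` {N - K + 1..N}) v"
proof -
  obtain A where A: "A \<subseteq> {1..N}" "\<K> = \<sigma> ` A" "card A = card \<K>"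
    using sorting_perm_preimage[OF \<sigma> \<K>(1)] .
  \<comment> \<open>Since K \<le> N, the subtraction does not truncate and
    \<open>{N - K + 1..N}\<close> has exactly K elements; every position outside it is smaller than
    all of them.\<close>
  show ?thesis
    unfolding A(2) by (rule sorting_perm_sum_le[OF \<sigma>]) (use A \<K> \<open>K \<le> N\<close> in auto)
qed

section \<open>The optimal bounds as attained extrema\<close>

lemma finite_card_subsets: "finite {\<K>. \<K> \<subseteq> {1..N::nat} \<and> card \<K> = K}"
  by (rule finite_subset[of _ "Pow {1..N}"]) auto

lemma card_subsets_nonempty:
  "K \<le> N \<Longrightarrow> {\<K>. \<K> \<subseteq> {1..N::nat} \<and> card \<K> = K} \<noteq> {}"
  using obtain_subset_with_card_n[of K "{1..N}"] by auto

text \<open>Supplies the boundedness without which \<open>INF\<close> and \<open>SUP\<close> over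
  the reals need not bound the individual values.\<close>

lemma compact_frame_form_image: "compact (frame_form \<phi> \<K> ` sphere 0 1)"
  unfolding frame_form_def by (intro compact_continuous_image continuous_intros) simp

lemma nerf_lower_le:
  assumes "\<K> \<subseteq> {1..N}" "card \<K> = K" "x \<in> sphere 0 1"
  shows "nerf_lower N \<phi> K \<le> frame_form \<phi> \<K> x"
proof -
  have "nerf_lower N \<phi> K \<le> (INF y\<in>sphere 0 1. frame_form \<phi> \<K> y)"
    unfolding nerf_lower_def frame_form_def
    by (rule Min_le) (use assms finite_card_subsets[of N K] in auto)
  also have "\<dots> \<le> frame_form \<phi> \<K> x"
    using compact_frame_form_image assms(3)
    by (intro cINF_lower bounded_imp_bdd_below compact_imp_bounded)
  finally show ?thesis .
qed

lemma le_nerf_upper: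
  assumes "\<K> \<subseteq> {1..N}" "card \<K> = K" "x \<in> sphere 0 1"
  shows "frame_form \<phi> \<K> x \<le> nerf_upper N \<phi> K"
proof -
  have "frame_form \<phi> \<K> x \<le> (SUP y\<in>sphere 0 1. frame_form \<phi> \<K> y)"
    using compact_frame_form_image assms(3)
    by (intro cSUP_upper bounded_imp_bdd_above compact_imp_bounded)
  also have "\<dots> \<le> nerf_upper N \<phi> K"
    unfolding nerf_upper_def frame_form_def
    by (rule Max_ge) (use assms finite_card_subsets[of N K] in auto)
  finally show ?thesis .
qed

text \<open>The optimal subset exists because there are finitely many candidates and, by K \<le> N,
  at least one; the optimal vector exists by compactness of the sphere.\<close>

lemma nerf_lower_attained:
  fixes \<phi> :: "nat \<Rightarrow> real ^ 'm"
  assumes "K \<le> N"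
  obtains \<K> x where "\<K> \<subseteq> {1..N}" "card \<K> = K" "x \<in> sphere 0 1"
    "nerf_lower N \<phi> K = frame_form \<phi> \<K> x"
proof -
  have "nerf_lower N \<phi> K \<in> (\<lambda>\<K>. INF x\<in>sphere 0 1. \<Sum>n\<in>\<K>. \<bar>x \<bullet> \<phi> n\<bar>\<^sup>2) `
          {\<K>. \<K> \<subseteq> {1..N} \<and> card \<K> = K}"
    unfolding nerf_lower_def
    by (rule Min_in) (use assms finite_card_subsets card_subsets_nonempty in auto)
  then obtain \<K> where \<K>: "\<K> \<subseteq> {1..N}" "card \<K> = K"
    "nerf_lower N \<phi> K = (INF x\<in>sphere 0 1. \<Sum>n\<in>\<K>. \<bar>x \<bullet> \<phi> n\<bar>\<^sup>2)"
    by blast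
  then show ?thesis
    using that inf_sphere_attained[of \<phi> \<K>] unfolding frame_form_def by metis
qed

lemma nerf_upper_attained:
  fixes \<phi> :: "nat \<Rightarrow> real ^ 'm"
  assumes "K \<le> N"
  obtains \<K> x where "\<K> \<subseteq> {1..N}" "card \<K> = K" "x \<in> sphere 0 1"
    "nerf_upper N \<phi> K = frame_form \<phi> \<K> x"
proof -
  have "nerf_upper N \<phi> K \<in> (\<lambda>\<K>. SUP x\<in>sphere 0 1. \<Sum>n\<in>\<K>. \<bar>x \<bullet> \<phi> n\<bar>\<^sup>2) `
          {\<K>. \<K> \<subseteq> {1..N} \<and> card \<K> = K}"
    unfolding nerf_upper_def
    by (rule Max_in) (use assms finite_card_subsets card_subsets_nonempty in auto)
  then obtain \<K> where \<K>: "\<K> \<subseteq> {1..N}" "card \<K> = K"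
    "nerf_upper N \<phi> K = (SUP x\<in>sphere 0 1. \<Sum>n\<in>\<K>. \<bar>x \<bullet> \<phi> n\<bar>\<^sup>2)"
    by blast
  then show ?thesis
    using that sup_sphere_attained[of \<phi> \<K>] unfolding frame_form_def by metis
qed

theorem theorem1:
  fixes \<phi> \<psi> :: "nat \<Rightarrow> real ^ 'm"
    and \<sigma> :: "nat \<Rightarrow> nat \<Rightarrow> nat"
    and K N P :: nat
    and \<epsilon> :: real
  assumes "CARD('m) \<le> K" and "K \<le> N"
    and "0 < \<epsilon>" and "\<epsilon> < 1"
    and "is_eps_net \<epsilon> P \<psi>"
    and "\<And>p. p \<in> {1..P} \<Longrightarrow> sorting_perm N \<phi> (\<psi> p) (\<sigma> p)"
  shows "1 / (1 - \<epsilon>\<^sup>2) * (approx_nerf_lower \<phi> P \<psi> \<sigma> K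
             - \<epsilon>\<^sup>2 / (1 - \<epsilon>\<^sup>2) * approx_nerf_upper N \<phi> P \<psi> \<sigma> K)
           \<le> nerf_lower N \<phi> K
       \<and> nerf_lower N \<phi> K \<le> approx_nerf_lower \<phi> P \<psi> \<sigma> K
       \<and> approx_nerf_upper N \<phi> P \<psi> \<sigma> K \<le> nerf_upper N \<phi> K
       \<and> nerf_upper N \<phi> K \<le> 1 / (1 - \<epsilon>\<^sup>2) * approx_nerf_upper N \<phi> P \<psi> \<sigma> K"
proof -
  let ?\<alpha> = "nerf_lower N \<phi> K" and ?\<beta> = "nerf_upper N \<phi> K"
  let ?a = "approx_nerf_lower \<phi> P \<psi> \<sigma> K" and ?b = "approx_nerf_upper N \<phi> P \<psi> \<sigma> K"
  note sort = assms(6)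
  have net: "\<exists>p\<in>{1..P}. 1 - \<epsilon>\<^sup>2 \<le> (x \<bullet> \<psi> p)\<^sup>2" if "x \<in> sphere 0 1" for x
    using assms(5) that unfolding is_eps_net_def by auto
  have unit: "\<psi> p \<in> sphere 0 1" if "p \<in> {1..P}" for p
    using assms(5) that unfolding is_eps_net_def by blast
  \<comment> \<open>A coordinate vector shows that the sphere is nonempty, so the net has a member.
    Hence \<open>Min\<close> and \<open>Max\<close> over the net are attained.\<close>
  have P: "{1..P} \<noteq> {}"
    using net[of "axis undefined 1"] by force
  have pos: "0 < 1 - \<epsilon>\<^sup>2"
    using assms(3,4) by (simp add: power_less_one_iff)

  have a_le: "?a \<le> frame_form \<phi> \<K> (\<psi> p)"
    if "p \<in> {1..P}" "\<K> \<subseteq> {1..N}" "card \<K> = K" for p \<K>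
  proof -
    have "?a \<le> (\<Sum>n=1..K. \<bar>\<psi> p \<bullet> \<phi> (\<sigma> p n)\<bar>\<^sup>2)"
      unfolding approx_nerf_lower_def by (rule Min_le) (use that in auto)
    then show ?thesis
      using sorting_perm_first_le[OF sort[OF that(1)] that(2,3) assms(2)]
      by (simp only: sorting_perm_sum_image[OF sort[OF that(1)]])
  qed
  have le_b: "frame_form \<phi> \<K> (\<psi> p) \<le> ?b"
    if "p \<in> {1..P}" "\<K> \<subseteq> {1..N}" "card \<K> = K" for p \<K>
  proof -
    have "(\<Sum>n=N-K+1..N. \<bar>\<psi> p \<bullet> \<phi> (\<sigma> p n)\<bar>\<^sup>2) \<le> ?b"
      unfolding approx_nerf_upper_def by (rule Max_ge) (use that in auto)
    then show ?thesis
      using sorting_perm_le_last[OF sort[OF that(1)] that(2,3) assms(2)]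
      by (simp only: sorting_perm_sum_image[OF sort[OF that(1)]])
  qed

  \<comment> \<open>The minimising net vector, with the subset at its first K sorted positions, is
    one of the competitors in the definition of \<open>?\<alpha>\<close>.\<close>
  have 2: "?\<alpha> \<le> ?a"
  proof -
    have "?a \<in> (\<lambda>p. \<Sum>n=1..K. \<bar>\<psi> p \<bullet> \<phi> (\<sigma> p n)\<bar>\<^sup>2) ` {1..P}"
      unfolding approx_nerf_lower_def by (rule Min_in) (use P in auto)
    then obtain p where p: "p \<in> {1..P}" "?a = (\<Sum>n=1..K. \<bar>\<psi> p \<bullet> \<phi> (\<sigma> p n)\<bar>\<^sup>2)"
      by blast
    show ?thesis
      unfolding p(2) sorting_perm_sum_image[OF sort[OF p(1)]]
      by (rule nerf_lower_le)
        (use sorting_perm_image[OF sort[OF p(1)], of "{1..K}"] assms(2) unit p in auto)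
  qed
  have 3: "?b \<le> ?\<beta>"
  proof -
    have "?b \<in> (\<lambda>p. \<Sum>n=N-K+1..N. \<bar>\<psi> p \<bullet> \<phi> (\<sigma> p n)\<bar>\<^sup>2) ` {1..P}"
      unfolding approx_nerf_upper_def by (rule Max_in) (use P in auto)
    then obtain p where p: "p \<in> {1..P}" "?b = (\<Sum>n=N-K+1..N. \<bar>\<psi> p \<bullet> \<phi> (\<sigma> p n)\<bar>\<^sup>2)"
      by blast
    show ?thesis
      unfolding p(2) sorting_perm_sum_image[OF sort[OF p(1)]]
      by (rule le_nerf_upper)
        (use sorting_perm_image[OF sort[OF p(1)], of "{N-K+1..N}"] assms(2) unit p in auto)
  qed
  have 4: "?\<beta> \<le> 1 / (1 - \<epsilon>\<^sup>2) * ?b"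
  proof -
    obtain \<K> x where x: "\<K> \<subseteq> {1..N}" "card \<K> = K" "x \<in> sphere 0 1" "?\<beta> = frame_form \<phi> \<K> x"
      using nerf_upper_attained[OF assms(2)] .
    obtain p where p: "p \<in> {1..P}" "1 - \<epsilon>\<^sup>2 \<le> (x \<bullet> \<psi> p)\<^sup>2"
      using net[OF x(3)] by blast
    \<comment> \<open>\<open>?\<beta>\<close> is a value of the form and hence nonnegative, so the
      net inequality may be multiplied by it.\<close>
    have "(1 - \<epsilon>\<^sup>2) * ?\<beta> \<le> (x \<bullet> \<psi> p)\<^sup>2 * ?\<beta>"
      using p(2) by (rule mult_right_mono) (simp add: x(4) frame_form_nonneg)
    also have "\<dots> \<le> frame_form \<phi> \<K> (\<psi> p)"
      unfolding x(4) using le_nerf_upper[OF x(1,2), of _ \<phi>] unit[OF p(1)] x(3)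
      by (intro frame_form_near_maximiser) (simp_all only: x(4))
    also have "\<dots> \<le> ?b"
      by (rule le_b) (use p x in auto)
    finally show ?thesis
      using pos by (simp add: field_simps)
  qed
  have 1: "1 / (1 - \<epsilon>\<^sup>2) * (?a - \<epsilon>\<^sup>2 / (1 - \<epsilon>\<^sup>2) * ?b) \<le> ?\<alpha>"
  proof -
    obtain \<K> x where x: "\<K> \<subseteq> {1..N}" "card \<K> = K" "x \<in> sphere 0 1" "?\<alpha> = frame_form \<phi> \<K> x"
      using nerf_lower_attained[OF assms(2)] .
    obtain p where p: "p \<in> {1..P}" "1 - \<epsilon>\<^sup>2 \<le> (x \<bullet> \<psi> p)\<^sup>2"
      using net[OF x(3)] by blast
    have "?\<alpha> \<le> ?\<beta>"
      using 2 3 x le_nerf_upper by metis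
    have "?a \<le> frame_form \<phi> \<K> (\<psi> p)"
      by (rule a_le) (use p x in auto)
    also have "\<dots> \<le> (x \<bullet> \<psi> p)\<^sup>2 * ?\<alpha> + (1 - (x \<bullet> \<psi> p)\<^sup>2) * ?\<beta>"
      unfolding x(4)
      using nerf_lower_le[OF x(1,2), of _ \<phi>] le_nerf_upper[OF x(1,2), of _ \<phi>] unit[OF p(1)] x(3)
      by (intro frame_form_near_minimiser) (simp_all only: x(4))
    \<comment> \<open>In this form the bound is visibly nonincreasing in
      \<open>(x \<bullet> \<psi> p)\<^sup>2\<close>, because
      \<open>?\<alpha> \<le> ?\<beta>\<close>; the lower estimate from the net can therefore be
      substituted.\<close>
    also have "\<dots> = ?\<beta> - (x \<bullet> \<psi> p)\<^sup>2 * (?\<beta> - ?\<alpha>)"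
      by (simp add: algebra_simps)
    also have "\<dots> \<le> ?\<beta> - (1 - \<epsilon>\<^sup>2) * (?\<beta> - ?\<alpha>)"
      using mult_right_mono[OF p(2), of "?\<beta> - ?\<alpha>"] \<open>?\<alpha> \<le> ?\<beta>\<close> by simp
    also have "\<dots> = (1 - \<epsilon>\<^sup>2) * ?\<alpha> + \<epsilon>\<^sup>2 * ?\<beta>"
      by (simp add: algebra_simps)
    \<comment> \<open>Replacing the optimal upper bound by the computable one produces the inner
      factor \<open>1 / (1 - \<epsilon>\<^sup>2)\<close>; the outer one comes from solving for
      \<open>?\<alpha>\<close>.\<close>
    also have "\<dots> \<le> (1 - \<epsilon>\<^sup>2) * ?\<alpha> + \<epsilon>\<^sup>2 * (1 / (1 - \<epsilon>\<^sup>2) * ?b)"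
      using mult_left_mono[OF 4, of "\<epsilon>\<^sup>2"] by simp
    finally have "?a - \<epsilon>\<^sup>2 / (1 - \<epsilon>\<^sup>2) * ?b \<le> (1 - \<epsilon>\<^sup>2) * ?\<alpha>"
      by simp
    then show ?thesis
      using pos by (simp add: pos_divide_le_eq mult.commute)
  qed
  show ?thesis
    using 1 2 3 4 by blast
qed

end
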